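(* Let $0<r_0<r_1<r_2$, $p(r)=\frac1r$, $\rho(r)=\frac1r\left(\frac{r^2}{r_0^2}-1\right)$ on $[r_1,r_2]$, and $$\xi(r)=\int_{r_1}^r\sqrt{\frac{s^2}{r_0^2}-1}\,ds,\qquad L=\xi(r_2).$$ Then the system of Liouville–Green quasimodes $$R_m^{(LG)}(r)=\frac{1}{(p(r)\rho(r))^{1/4}}\sin\left(\frac{\pi m}{L}\xi(r)\right),\qquad m=1,2,\dots,$$ is complete in the weighted Hilbert space $\mathcal H=L^2_\rho(r_1,r_2)$, i.e. the linear span of $\{R_m^{(LG)}\}_{m\ge1}$ is dense in $\mathcal H$.
   Context: $L^2_\rho(r_1,r_2)$ is the weighted Hilbert space with scalar product $\langle f,g\rangle_\rho=\int_{r_1}^{r_2}f(r)\overline{g(r)}\rho(r)\,dr$. *)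

theory Defs
  imports "HOL-Analysis.Analysis" "HOL-Library.Function_Algebras"
begin

(* Elements of L^2_w(a,b) are represented by functions rather than by classes modulo
   equality almost everywhere; values outside (a,b) are irrelevant. *)
definition weighted_L2 :: "real \<Rightarrow> real \<Rightarrow> (real \<Rightarrow> real) \<Rightarrow> (real \<Rightarrow> complex) set" where
  "weighted_L2 a b w =
     {f. f \<in> borel_measurable (lebesgue_on {a<..<b}) \<and>
         integrable (lebesgue_on {a<..<b}) (\<lambda>r. (cmod (f r))\<^sup>2 * w r)}"

definition weighted_inner ::
  "real \<Rightarrow> real \<Rightarrow> (real \<Rightarrow> real) \<Rightarrow> (real \<Rightarrow> complex) \<Rightarrow> (real \<Rightarrow> complex) \<Rightarrow> complex" where
  "weighted_inner a b w f g =
     integral\<^sup>L (lebesgue_on {a<..<b}) (\<lambda>r. f r * cnj (g r) * complex_of_real (w r))"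

definition weighted_norm :: "real \<Rightarrow> real \<Rightarrow> (real \<Rightarrow> real) \<Rightarrow> (real \<Rightarrow> complex) \<Rightarrow> real" where
  "weighted_norm a b w f = sqrt (Re (weighted_inner a b w f f))"

definition fun_scale :: "complex \<Rightarrow> (real \<Rightarrow> complex) \<Rightarrow> real \<Rightarrow> complex" where
  "fun_scale c f = (\<lambda>r. c * f r)"

lemma vector_space_fun_scale: "vector_space fun_scale"
  by unfold_locales (auto simp: fun_scale_def fun_eq_iff algebra_simps)

abbreviation complex_span :: "(real \<Rightarrow> complex) set \<Rightarrow> (real \<Rightarrow> complex) set" where
  "complex_span \<equiv> module.span fun_scale"

definition complete_in_weighted_L2 ::
  "real \<Rightarrow> real \<Rightarrow> (real \<Rightarrow> real) \<Rightarrow> (real \<Rightarrow> complex) set \<Rightarrow> bool" where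
  "complete_in_weighted_L2 a b w S \<longleftrightarrow>
     S \<subseteq> weighted_L2 a b w \<and>
     (\<forall>f\<in>weighted_L2 a b w. \<forall>\<epsilon>>0. \<exists>g\<in>complex_span S. weighted_norm a b w (f - g) < \<epsilon>)"

definition LG_quasimode ::
  "(real \<Rightarrow> real) \<Rightarrow> (real \<Rightarrow> real) \<Rightarrow> (real \<Rightarrow> real) \<Rightarrow> real \<Rightarrow> nat \<Rightarrow> real \<Rightarrow> complex" where
  "LG_quasimode p \<rho> \<xi> L m =
     (\<lambda>r. complex_of_real (1 / (p r * \<rho> r) powr (1/4) * sin (pi * real m / L * \<xi> r)))"

end

theory Submission
  imports Defs
begin

text \<open>
  Put \<open>\<theta> = \<pi> \<xi> / L\<close> and let \<open>\<psi> = (p \<rho>)^(-1/4) sin \<theta>\<close> be the first quasimode, which is positive on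
  \<open>(r1, r2)\<close>. No change of variables is needed. On the one hand, every \<open>f\<close> in the weighted space is
  a limit of products \<open>\<psi> h\<close> with \<open>h\<close> continuous: truncate \<open>f / \<psi>\<close>, approximate the truncation by
  continuous functions almost everywhere, and use dominated convergence twice. On the other hand,
  the continuous functions which multiply the span of the quasimodes into itself form a ring, and
  it contains \<open>cos \<theta>\<close> because
  \<open>2 cos \<theta> sin (m \<theta>) = sin ((m + 1) \<theta>) + sin ((m - 1) \<theta>)\<close>. As \<open>cos \<theta>\<close> is injective on \<open>[r1, r2]\<close>,
  Stone--Weierstrass makes these multipliers uniformly dense in the continuous functions, so that
  \<open>\<psi> h\<close> is a limit of elements of the span.
\<close>

section \<open>Real functions that are square integrable for a continuous nonnegative weight\<close>

locale interval_weight =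
  fixes a b :: real and w :: "real \<Rightarrow> real"
  assumes continuous_weight: "continuous_on {a..b} w"
    and weight_nonneg: "\<And>x. x \<in> {a..b} \<Longrightarrow> 0 \<le> w x"
begin

abbreviation M :: "real measure" where "M \<equiv> lebesgue_on {a<..<b}"

text \<open>Real-valued because the Stone-Weierstrass theorem used below concerns real functions;
  complex functions enter later through their real and imaginary parts.\<close>

definition sq_integrable :: "(real \<Rightarrow> real) \<Rightarrow> bool" where
  "sq_integrable v \<longleftrightarrow> v \<in> borel_measurable M \<and> integrable M (\<lambda>x. (v x)\<^sup>2 * w x)"

definition sq_integral :: "(real \<Rightarrow> real) \<Rightarrow> real" where
  "sq_integral v = integral\<^sup>L M (\<lambda>x. (v x)\<^sup>2 * w x)"

lemma weight_nonneg_M: "x \<in> space M \<Longrightarrow> 0 \<le> w x"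
  using weight_nonneg by simp

lemma measurable_continuous:
  fixes g :: "real \<Rightarrow> 'a :: euclidean_space"
  assumes "continuous_on {a..b} g"
  shows "g \<in> borel_measurable M"
proof (rule continuous_imp_measurable_on_sets_lebesgue)
  show "continuous_on {a<..<b} g"
    by (rule continuous_on_subset[OF assms]) auto
qed auto

lemma measurable_weight [measurable]: "w \<in> borel_measurable M"
  by (rule measurable_continuous[OF continuous_weight])

lemma integrable_continuous:
  fixes g :: "real \<Rightarrow> real"
  assumes "continuous_on {a..b} g"
  shows "integrable M g"
proof -
  interpret finite_measure M
    by (rule finite_measure_lebesgue_on) (simp add: lmeasurable_box)
  have "bounded (g ` {a..b})"
    by (intro compact_imp_bounded compact_continuous_image assms compact_Icc)
  then obtain B where B: "\<And>x. x \<in> {a..b} \<Longrightarrow> norm (g x) \<le> B"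
    unfolding bounded_iff by blast
  show ?thesis
  proof (rule integrable_const_bound)
    show "AE x in M. norm (g x) \<le> B"
      by (rule AE_I2) (use B in auto)
  qed (rule measurable_continuous[OF assms])
qed

lemma sq_integrable_continuous:
  assumes "continuous_on {a..b} g"
  shows "sq_integrable g"
  unfolding sq_integrable_def
  by (intro conjI measurable_continuous integrable_continuous continuous_intros assms
      continuous_weight)

lemma sq_integrable_bound:
  assumes D: "sq_integrable D" and v: "v \<in> borel_measurable M"
    and le: "\<And>x. x \<in> {a<..<b} \<Longrightarrow> \<bar>v x\<bar> \<le> \<bar>D x\<bar>"
  shows "sq_integrable v"
  unfolding sq_integrable_def
proof
  show "integrable M (\<lambda>x. (v x)\<^sup>2 * w x)"
  proof (rule Bochner_Integration.integrable_bound)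
    show "integrable M (\<lambda>x. (D x)\<^sup>2 * w x)"
      using D by (simp add: sq_integrable_def)
    show "(\<lambda>x. (v x)\<^sup>2 * w x) \<in> borel_measurable M"
      using v by measurable
    have "norm ((v x)\<^sup>2 * w x) \<le> norm ((D x)\<^sup>2 * w x)" if "x \<in> space M" for x
      using that le[of x] weight_nonneg_M[OF that]
      by (simp add: abs_mult mult_right_mono abs_le_square_iff)
    then show "AE x in M. norm ((v x)\<^sup>2 * w x) \<le> norm ((D x)\<^sup>2 * w x)"
      by (intro AE_I2)
  qed
qed (rule v)

lemma square_add_weight_le:
  assumes "x \<in> space M"
  shows "(u x + v x)\<^sup>2 * w x \<le> 2 * ((u x)\<^sup>2 * w x) + 2 * ((v x)\<^sup>2 * w x)"
proof -
  have "(u x + v x)\<^sup>2 \<le> 2 * (u x)\<^sup>2 + 2 * (v x)\<^sup>2"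
    using sum_squares_bound[of "u x" "v x"] by (simp add: power2_sum)
  from mult_right_mono[OF this weight_nonneg_M[OF assms]] show ?thesis
    by (simp add: algebra_simps)
qed

lemma sq_integrable_add:
  assumes u: "sq_integrable u" and v: "sq_integrable v"
  shows "sq_integrable (\<lambda>x. u x + v x)"
  unfolding sq_integrable_def
proof
  have [measurable]: "u \<in> borel_measurable M" "v \<in> borel_measurable M"
    using u v by (auto simp: sq_integrable_def)
  show "(\<lambda>x. u x + v x) \<in> borel_measurable M"
    by measurable
  show "integrable M (\<lambda>x. (u x + v x)\<^sup>2 * w x)"
  proof (rule Bochner_Integration.integrable_bound)
    show "integrable M (\<lambda>x. 2 * ((u x)\<^sup>2 * w x) + 2 * ((v x)\<^sup>2 * w x))"
      using u v by (simp add: sq_integrable_def)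
    show "(\<lambda>x. (u x + v x)\<^sup>2 * w x) \<in> borel_measurable M"
      by measurable
    have "norm ((u x + v x)\<^sup>2 * w x) \<le> norm (2 * ((u x)\<^sup>2 * w x) + 2 * ((v x)\<^sup>2 * w x))"
      if "x \<in> space M" for x
      using square_add_weight_le[OF that, of u v] weight_nonneg_M[OF that]
      by simp
    then show "AE x in M. norm ((u x + v x)\<^sup>2 * w x)
        \<le> norm (2 * ((u x)\<^sup>2 * w x) + 2 * ((v x)\<^sup>2 * w x))"
      by (intro AE_I2)
  qed
qed

lemma sq_integrable_diff:
  assumes u: "sq_integrable u" and v: "sq_integrable v"
  shows "sq_integrable (\<lambda>x. u x - v x)"
proof -
  have "sq_integrable (\<lambda>x. - v x)"
    using v by (simp add: sq_integrable_def)
  from sq_integrable_add[OF u this] show ?thesis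
    by simp
qed

text \<open>Stands in for the triangle inequality and follows pointwise from 2uv <= u^2 + v^2.
  Because of the factors 2, two errors below e/4 combine to an error below e.\<close>

lemma sq_integral_add_le:
  assumes u: "sq_integrable u" and v: "sq_integrable v"
  shows "sq_integral (\<lambda>x. u x + v x) \<le> 2 * sq_integral u + 2 * sq_integral v"
proof -
  have "sq_integral (\<lambda>x. u x + v x)
      \<le> integral\<^sup>L M (\<lambda>x. 2 * ((u x)\<^sup>2 * w x) + 2 * ((v x)\<^sup>2 * w x))"
    unfolding sq_integral_def
    using sq_integrable_add[OF u v] u v
    by (intro integral_mono square_add_weight_le) (auto simp: sq_integrable_def)
  also have "\<dots> = 2 * sq_integral u + 2 * sq_integral v"
    using u v by (simp add: sq_integrable_def sq_integral_def)
  finally show ?thesis .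
qed

text \<open>Turns almost everywhere convergence into convergence in the weighted norm, given one
  square integrable majorant for the whole sequence. Each approximation step below comes down to
  finding such a \<open>D\<close>.\<close>

lemma sq_integral_dominated_tendsto_0:
  assumes D: "sq_integrable D" and v: "\<And>n. v n \<in> borel_measurable M"
    and le: "\<And>n x. x \<in> {a<..<b} \<Longrightarrow> \<bar>v n x\<bar> \<le> \<bar>D x\<bar>"
    and lim: "AE x in M. (\<lambda>n. v n x) \<longlonglongrightarrow> 0"
  shows "(\<lambda>n. sq_integral (v n)) \<longlonglongrightarrow> 0"
proof -
  have "(\<lambda>n. integral\<^sup>L M (\<lambda>x. (v n x)\<^sup>2 * w x)) \<longlonglongrightarrow> integral\<^sup>L M (\<lambda>x. 0)"
  proof (rule integral_dominated_convergence)
    show "integrable M (\<lambda>x. (D x)\<^sup>2 * w x)"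
      using D by (simp add: sq_integrable_def)
    show "(\<lambda>x. (v n x)\<^sup>2 * w x) \<in> borel_measurable M" for n
      using v[of n] by measurable
    show "AE x in M. (\<lambda>n. (v n x)\<^sup>2 * w x) \<longlonglongrightarrow> 0"
      using lim by eventually_elim (auto intro!: tendsto_eq_intros)
    have "norm ((v n x)\<^sup>2 * w x) \<le> (D x)\<^sup>2 * w x" if "x \<in> space M" for x n
      using that le[of x n] weight_nonneg_M[OF that]
      by (simp add: abs_mult mult_right_mono abs_le_square_iff)
    then show "AE x in M. norm ((v n x)\<^sup>2 * w x) \<le> (D x)\<^sup>2 * w x" for n
      by (intro AE_I2)
  qed simp
  then show ?thesis
    by (simp add: sq_integral_def)
qed

section \<open>Truncation and density of the multiples of a fixed positive function\<close>

definition clip :: "real \<Rightarrow> real \<Rightarrow> real" where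
  "clip k y = max (- k) (min k y)"

lemma abs_clip_le: "0 \<le> k \<Longrightarrow> \<bar>clip k y\<bar> \<le> k"
  by (auto simp: clip_def)

lemma clip_eq: "\<bar>y\<bar> \<le> k \<Longrightarrow> clip k y = y"
  by (auto simp: clip_def)

lemma abs_diff_clip_le: "0 \<le> k \<Longrightarrow> \<bar>y - clip k y\<bar> \<le> \<bar>y\<bar>"
  by (auto simp: clip_def min_def max_def)

lemma continuous_on_clip [continuous_intros]:
  "continuous_on S f \<Longrightarrow> continuous_on S (\<lambda>x. clip k (f x))"
  unfolding clip_def by (intro continuous_intros)

lemma measurable_clip [measurable]: "clip k \<in> borel_measurable borel"
  unfolding clip_def by measurable

text \<open>The quotient \<open>F\<close> = \<open>u\<close> / \<open>\<psi>\<close> need not be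
  bounded, since \<open>\<psi>\<close> may vanish at the endpoints. So \<open>F\<close> is first
  truncated at a level \<open>k\<close>, and only then is the bounded truncation replaced by a
  continuous function.\<close>

lemma approx_by_continuous_multiple:
  assumes u: "sq_integrable u" and cont: "continuous_on {a..b} \<psi>"
    and pos: "\<And>x. x \<in> {a<..<b} \<Longrightarrow> 0 < \<psi> x" and "0 < e"
  obtains h where "continuous_on {a..b} h" "sq_integral (\<lambda>x. u x - \<psi> x * h x) < e"
proof -
  define F where "F x = u x / \<psi> x" for x
  have [measurable]: "u \<in> borel_measurable M" "\<psi> \<in> borel_measurable M"
    using u measurable_continuous[OF cont] by (auto simp: sq_integrable_def)
  have F [measurable]: "F \<in> borel_measurable M"
    unfolding F_def by measurable
  have uF: "u x = \<psi> x * F x" if "x \<in> {a<..<b}" for x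
    using pos[OF that] by (simp add: F_def)

  \<comment> \<open>Truncation never increases the modulus of the remainder, so \<open>u\<close>
    itself is the majorant for all levels \<open>k\<close>.\<close>
  have trunc_bound: "\<bar>u x - \<psi> x * clip (real k) (F x)\<bar> \<le> \<bar>u x\<bar>" if "x \<in> {a<..<b}" for x k
    using abs_diff_clip_le[of "real k" "F x"] pos[OF that]
    by (simp add: uF[OF that] abs_mult flip: right_diff_distrib)
  have "(\<lambda>k. sq_integral (\<lambda>x. u x - \<psi> x * clip (real k) (F x))) \<longlonglongrightarrow> 0"
  proof (rule sq_integral_dominated_tendsto_0[OF u])
    show "(\<lambda>x. u x - \<psi> x * clip (real k) (F x)) \<in> borel_measurable M" for k
      by measurable
    \<comment> \<open>At a fixed point the remainder is exactly zero as soon as \<open>k\<close>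
      exceeds the modulus of \<open>F x\<close>.\<close>
    have "(\<lambda>k. u x - \<psi> x * clip (real k) (F x)) \<longlonglongrightarrow> 0" if "x \<in> space M" for x
    proof (rule tendsto_eventually)
      obtain K :: nat where K: "\<bar>F x\<bar> \<le> real K"
        using real_arch_simple by blast
      show "eventually (\<lambda>k. u x - \<psi> x * clip (real k) (F x) = 0) sequentially"
        using eventually_ge_at_top[of K]
      proof eventually_elim
        case (elim k)
        then have "clip (real k) (F x) = F x"
          using K by (intro clip_eq) simp
        then show ?case
          using that by (simp add: uF)
      qed
    qed
    then show "AE x in M. (\<lambda>k. u x - \<psi> x * clip (real k) (F x)) \<longlonglongrightarrow> 0"
      by (intro AE_I2)
  qed (rule trunc_bound)
  then have "eventually (\<lambda>k. sq_integral (\<lambda>x. u x - \<psi> x * clip (real k) (F x)) < e / 4) sequentially"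
    by (rule order_tendstoD) (use \<open>0 < e\<close> in simp)
  then obtain k :: nat where k: "sq_integral (\<lambda>x. u x - \<psi> x * clip (real k) (F x)) < e / 4"
    by (auto simp: eventually_sequentially)
  have si1: "sq_integrable (\<lambda>x. u x - \<psi> x * clip (real k) (F x))"
    by (rule sq_integrable_bound[OF u _ trunc_bound]) measurable

  \<comment> \<open>This notion of measurability supplies continuous functions \<open>g n\<close>
    that converge to \<open>F\<close> off a negligible set.\<close>
  have "F measurable_on {a<..<b}"
    using F by (subst measurable_on_iff_borel_measurable) auto
  then obtain N g where N: "negligible N" and g: "\<And>n. continuous_on UNIV (g n :: real \<Rightarrow> real)"
    and lim: "\<And>x. x \<notin> N \<Longrightarrow> (\<lambda>n. g n x) \<longlonglongrightarrow> (if x \<in> {a<..<b} then F x else 0)"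
    unfolding measurable_on_def by auto
  have g_ab: "continuous_on {a..b} (g n)" for n
    by (rule continuous_on_subset[OF g]) simp
  have [measurable]: "g n \<in> borel_measurable M" for n
    by (rule measurable_continuous[OF g_ab])
  \<comment> \<open>The \<open>g n\<close> come without a common bound, so they are clipped as well.
    Two clipped values differ by at most 2k, which yields this majorant.\<close>
  have D: "sq_integrable (\<lambda>x. 2 * real k * \<psi> x)"
    by (intro sq_integrable_continuous continuous_intros cont)
  have diff_bound: "\<bar>\<psi> x * clip k (F x) - \<psi> x * clip k (g n x)\<bar> \<le> \<bar>2 * real k * \<psi> x\<bar>"
    if "x \<in> {a<..<b}" for x n
  proof -
    have "\<bar>clip k (F x) - clip k (g n x)\<bar> \<le> 2 * real k"
      using abs_clip_le[of "real k" "F x"] abs_clip_le[of "real k" "g n x"] by simp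
    from mult_left_mono[OF this, of "\<psi> x"] pos[OF that] show ?thesis
      by (simp add: abs_mult mult_ac flip: right_diff_distrib)
  qed
  have "(\<lambda>n. sq_integral (\<lambda>x. \<psi> x * clip k (F x) - \<psi> x * clip k (g n x))) \<longlonglongrightarrow> 0"
  proof (rule sq_integral_dominated_tendsto_0[OF D])
    show "(\<lambda>x. \<psi> x * clip k (F x) - \<psi> x * clip k (g n x)) \<in> borel_measurable M" for n
      by measurable
    have "AE x in lebesgue. x \<notin> N"
      using N by (auto simp: negligible_iff_null_sets intro: AE_not_in)
    then have "AE x in M. x \<notin> N"
      by (subst AE_restrict_space_iff) (auto elim: eventually_mono)
    moreover have "AE x in M. x \<in> {a<..<b}"
      by (rule AE_I2) simp
    ultimately show "AE x in M. (\<lambda>n. \<psi> x * clip k (F x) - \<psi> x * clip k (g n x)) \<longlonglongrightarrow> 0"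
    proof eventually_elim
      case (elim x)
      then have "(\<lambda>n. g n x) \<longlonglongrightarrow> F x"
        using lim[of x] by simp
      then have "(\<lambda>n. clip k (g n x)) \<longlonglongrightarrow> clip k (F x)"
        unfolding clip_def by (intro tendsto_intros)
      then have "(\<lambda>n. \<psi> x * clip k (F x) - \<psi> x * clip k (g n x))
          \<longlonglongrightarrow> \<psi> x * clip k (F x) - \<psi> x * clip k (F x)"
        by (intro tendsto_intros)
      then show ?case
        by simp
    qed
  qed (rule diff_bound)
  then have "eventually (\<lambda>n. sq_integral (\<lambda>x. \<psi> x * clip k (F x) - \<psi> x * clip k (g n x)) < e / 4)
      sequentially"
    by (rule order_tendstoD) (use \<open>0 < e\<close> in simp)
  then obtain n where n: "sq_integral (\<lambda>x. \<psi> x * clip k (F x) - \<psi> x * clip k (g n x)) < e / 4"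
    by (auto simp: eventually_sequentially)
  have si2: "sq_integrable (\<lambda>x. \<psi> x * clip k (F x) - \<psi> x * clip k (g n x))"
    by (rule sq_integrable_bound[OF D _ diff_bound]) measurable

  show thesis
  proof (rule that)
    show "continuous_on {a..b} (\<lambda>x. clip k (g n x))"
      by (intro continuous_intros g_ab)
    \<comment> \<open>The two remainders telescope: the middle term
      \<open>\<psi> x * clip k (F x)\<close> cancels in their sum.\<close>
    show "sq_integral (\<lambda>x. u x - \<psi> x * clip k (g n x)) < e"
      using sq_integral_add_le[OF si1 si2] k n by simp
  qed
qed

text \<open>The ring \<open>R\<close> is uniformly dense in the continuous functions by
  Stone-Weierstrass, and multiplication by the square integrable \<open>\<psi>\<close> turns uniform
  convergence into convergence in the weighted norm.\<close>

lemma approx_by_ring_multiple: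
  assumes R: "function_ring_on R {a..b}"
    and u: "sq_integrable u" and cont: "continuous_on {a..b} \<psi>"
    and pos: "\<And>x. x \<in> {a<..<b} \<Longrightarrow> 0 < \<psi> x" and "0 < e"
  obtains q where "q \<in> R" "sq_integral (\<lambda>x. u x - \<psi> x * q x) < e"
proof -
  interpret function_ring_on R "{a..b}" by (rule R)
  obtain h where h: "continuous_on {a..b} h" and uh: "sq_integral (\<lambda>x. u x - \<psi> x * h x) < e / 4"
    using approx_by_continuous_multiple[OF u cont pos, of "e / 4"] \<open>0 < e\<close> by auto
  \<comment> \<open>These tolerances tend to 0 and never exceed 1; the second property makes
    \<open>\<psi>\<close> a majorant for every n.\<close>
  have "\<exists>q\<in>R. \<forall>x\<in>{a..b}. \<bar>h x - q x\<bar> < 1 / real (Suc n)" for n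
    by (rule Stone_Weierstrass_basic[OF h]) simp
  then obtain q where q: "\<And>n. q n \<in> R"
    and hq: "\<And>n x. x \<in> {a..b} \<Longrightarrow> \<bar>h x - q n x\<bar> < 1 / real (Suc n)"
    by metis
  have qc: "continuous_on {a..b} (q n)" for n
    by (rule continuous[OF q])
  have dc: "continuous_on {a..b} (\<lambda>x. \<psi> x * h x - \<psi> x * q n x)" for n
    by (intro continuous_intros cont h qc)
  have "(\<lambda>n. sq_integral (\<lambda>x. \<psi> x * h x - \<psi> x * q n x)) \<longlonglongrightarrow> 0"
  proof (rule sq_integral_dominated_tendsto_0[OF sq_integrable_continuous[OF cont]])
    show "(\<lambda>x. \<psi> x * h x - \<psi> x * q n x) \<in> borel_measurable M" for n
      by (rule measurable_continuous[OF dc])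
    show "\<bar>\<psi> x * h x - \<psi> x * q n x\<bar> \<le> \<bar>\<psi> x\<bar>" if "x \<in> {a<..<b}" for n x
    proof -
      have "\<bar>h x - q n x\<bar> \<le> 1"
        using hq[of x n] that by (rule_tac order.trans[OF less_imp_le]) auto
      from mult_left_mono[OF this, of "\<bar>\<psi> x\<bar>"] show ?thesis
        by (simp add: abs_mult flip: right_diff_distrib)
    qed
    have "(\<lambda>n. \<psi> x * h x - \<psi> x * q n x) \<longlonglongrightarrow> 0" if "x \<in> space M" for x
    proof -
      have "(\<lambda>n. h x - q n x) \<longlonglongrightarrow> 0"
      proof (rule Lim_null_comparison[OF _ LIMSEQ_inverse_real_of_nat])
        show "eventually (\<lambda>n. norm (h x - q n x) \<le> inverse (real (Suc n))) sequentially"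
          using hq[of x] that by (auto intro!: always_eventually less_imp_le simp: divide_simps)
      qed
      from tendsto_mult_left[OF this, of "\<psi> x"] show ?thesis
        by (simp add: right_diff_distrib)
    qed
    then show "AE x in M. (\<lambda>n. \<psi> x * h x - \<psi> x * q n x) \<longlonglongrightarrow> 0"
      by (intro AE_I2)
  qed
  then have "eventually (\<lambda>n. sq_integral (\<lambda>x. \<psi> x * h x - \<psi> x * q n x) < e / 4) sequentially"
    by (rule order_tendstoD) (use \<open>0 < e\<close> in simp)
  then obtain n where n: "sq_integral (\<lambda>x. \<psi> x * h x - \<psi> x * q n x) < e / 4"
    by (auto simp: eventually_sequentially)
  have si: "sq_integrable (\<lambda>x. u x - \<psi> x * h x)"
    by (intro sq_integrable_diff u sq_integrable_continuous continuous_intros cont h)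
  have "sq_integral (\<lambda>x. u x - \<psi> x * q n x) < e"
    using sq_integral_add_le[OF si sq_integrable_continuous[OF dc[of n]]] uh n by simp
  with q show thesis
    by (rule that)
qed

section \<open>Complex-valued functions and a completeness criterion by multipliers\<close>

lemma weighted_L2_Re_Im:
  assumes "f \<in> weighted_L2 a b w"
  shows "sq_integrable (\<lambda>x. Re (f x))" "sq_integrable (\<lambda>x. Im (f x))"
proof -
  have [measurable]: "f \<in> borel_measurable M"
    using assms by (simp add: weighted_L2_def)
  have "sq_integrable (\<lambda>x. cmod (f x))"
    using assms unfolding sq_integrable_def weighted_L2_def by auto
  from sq_integrable_bound[OF this] show "sq_integrable (\<lambda>x. Re (f x))"
    and "sq_integrable (\<lambda>x. Im (f x))"
    by (auto simp: abs_Re_le_cmod abs_Im_le_cmod)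
qed

text \<open>As f times its conjugate is the sum of the squares of the real and imaginary parts,
  these two parts can be approximated independently.\<close>

lemma weighted_norm_eq:
  assumes "sq_integrable (\<lambda>x. Re (f x))" "sq_integrable (\<lambda>x. Im (f x))"
  shows "weighted_norm a b w f
    = sqrt (sq_integral (\<lambda>x. Re (f x)) + sq_integral (\<lambda>x. Im (f x)))"
proof -
  have "weighted_inner a b w f f
      = integral\<^sup>L M (\<lambda>x. complex_of_real ((Re (f x))\<^sup>2 * w x + (Im (f x))\<^sup>2 * w x))"
    unfolding weighted_inner_def
    by (intro Bochner_Integration.integral_cong)
      (auto simp: complex_mult_cnj distrib_right)
  also have "\<dots> = complex_of_real (sq_integral (\<lambda>x. Re (f x)) + sq_integral (\<lambda>x. Im (f x)))"
    using assms unfolding sq_integrable_def sq_integral_def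
    by (subst integral_complex_of_real) simp
  finally show ?thesis
    by (simp add: weighted_norm_def)
qed

lemma weighted_L2_continuous:
  fixes f :: "real \<Rightarrow> complex"
  assumes "continuous_on {a..b} f"
  shows "f \<in> weighted_L2 a b w"
  unfolding weighted_L2_def
  by (auto intro!: measurable_continuous integrable_continuous continuous_intros assms
      continuous_weight)

text \<open>Isolates what the sine system has to provide: one continuous member positive in the
  interior, and one continuous injective function \<open>c\<close> that keeps the span invariant
  under multiplication.\<close>

lemma complete_of_multipliers:
  fixes \<psi> c :: "real \<Rightarrow> real" and S :: "(real \<Rightarrow> complex) set"
  assumes S: "\<And>g. g \<in> S \<Longrightarrow> continuous_on {a..b} g"
    and \<psi>: "(\<lambda>x. complex_of_real (\<psi> x)) \<in> S"
    and pos: "\<And>x. x \<in> {a<..<b} \<Longrightarrow> 0 < \<psi> x"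
    and c: "continuous_on {a..b} c" and inj: "inj_on c {a..b}"
    and mult: "\<And>g. g \<in> S \<Longrightarrow> (\<lambda>x. complex_of_real (c x) * g x) \<in> complex_span S"
  shows "complete_in_weighted_L2 a b w S"
  unfolding complete_in_weighted_L2_def
proof (intro conjI ballI allI impI)
  interpret V: vector_space fun_scale by (rule vector_space_fun_scale)
  let ?V = "complex_span S"
  have add_V: "(\<lambda>x. g x + h x) \<in> ?V" if "g \<in> ?V" "h \<in> ?V" for g h
    using V.span_add[OF that] by (simp add: plus_fun_def)
  have scale_V: "(\<lambda>x. k * g x) \<in> ?V" if "g \<in> ?V" for g k
    using V.span_scale[OF that, of k] by (simp add: fun_scale_def)
  \<comment> \<open>The multipliers of the span. Products stay in \<open>R\<close> because the
    multiplications compose, and constants belong to it because they act as scalars. Continuity is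
    asked on the closed interval only, while the products are formed on the whole line, as span
    members are functions there.\<close>
  define R where "R = {h :: real \<Rightarrow> real. continuous_on {a..b} h \<and>
      (\<forall>g\<in>?V. (\<lambda>x. complex_of_real (h x) * g x) \<in> ?V)}"
  \<comment> \<open>By linearity, invariance under \<open>c\<close> passes from the generators to
    their span.\<close>
  have c_V: "(\<lambda>x. complex_of_real (c x) * g x) \<in> ?V" if "g \<in> ?V" for g
    using that
  proof (induction rule: V.span_induct_alt)
    case base
    have "(\<lambda>x. complex_of_real (c x) * (0 :: real \<Rightarrow> complex) x) = 0"
      by (simp add: fun_eq_iff)
    then show ?case
      using V.span_zero by simp
  next
    case (step k x y)
    have "(\<lambda>t. complex_of_real (c t) * (fun_scale k x + y) t)
        = (\<lambda>t. k * (complex_of_real (c t) * x t) + complex_of_real (c t) * y t)"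
      by (simp add: fun_eq_iff fun_scale_def algebra_simps)
    then show ?case
      using add_V[OF scale_V[OF mult[OF step(1)]] step(2)] by simp
  qed
  have R: "function_ring_on R {a..b}"
  proof
    show "compact {a..b}" by simp
    show "continuous_on {a..b} f" if "f \<in> R" for f
      using that by (simp add: R_def)
    show "(\<lambda>x. f x + g x) \<in> R" if "f \<in> R" "g \<in> R" for f g
      using that by (auto simp: R_def distrib_right intro!: continuous_intros add_V)
    show "(\<lambda>x. f x * g x) \<in> R" if "f \<in> R" "g \<in> R" for f g
      using that by (auto simp: R_def mult.assoc intro!: continuous_intros)
    show "(\<lambda>_. k) \<in> R" for k
      by (auto simp: R_def intro!: scale_V)
    \<comment> \<open>The injective multiplier \<open>c\<close> alone separates all points.\<close>
    show "\<exists>f\<in>R. f x \<noteq> f y" if "x \<in> {a..b}" "y \<in> {a..b}" "x \<noteq> y" for x y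
    proof
      show "c \<in> R"
        using c c_V by (simp add: R_def)
      show "c x \<noteq> c y"
        using inj that by (auto dest: inj_onD)
    qed
  qed
  show "S \<subseteq> weighted_L2 a b w"
    using S weighted_L2_continuous by blast
  fix f :: "real \<Rightarrow> complex" and e :: real
  assume f: "f \<in> weighted_L2 a b w" and "0 < e"
  have \<psi>c: "continuous_on {a..b} \<psi>"
    using continuous_on_Re[OF S[OF \<psi>]] by simp
  have e: "0 < e\<^sup>2 / 2"
    using \<open>0 < e\<close> by simp
  obtain q1 where q1: "q1 \<in> R" "sq_integral (\<lambda>x. Re (f x) - \<psi> x * q1 x) < e\<^sup>2 / 2"
    using approx_by_ring_multiple[OF R weighted_L2_Re_Im(1)[OF f] \<psi>c pos e] .
  obtain q2 where q2: "q2 \<in> R" "sq_integral (\<lambda>x. Im (f x) - \<psi> x * q2 x) < e\<^sup>2 / 2"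
    using approx_by_ring_multiple[OF R weighted_L2_Re_Im(2)[OF f] \<psi>c pos e] .
  \<comment> \<open>Both products lie in the span because \<open>q1\<close> and \<open>q2\<close>
    are multipliers and \<open>\<psi>\<close> is a generator; the scalar \<i> is available since the
    span is complex.\<close>
  define g where "g x = complex_of_real (q1 x) * complex_of_real (\<psi> x)
      + \<i> * (complex_of_real (q2 x) * complex_of_real (\<psi> x))" for x
  have Re: "(\<lambda>x. Re ((f - g) x)) = (\<lambda>x. Re (f x) - \<psi> x * q1 x)"
    and Im: "(\<lambda>x. Im ((f - g) x)) = (\<lambda>x. Im (f x) - \<psi> x * q2 x)"
    by (auto simp: g_def fun_eq_iff)
  have "weighted_norm a b w (f - g) = sqrt (sq_integral (\<lambda>x. Re (f x) - \<psi> x * q1 x)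
      + sq_integral (\<lambda>x. Im (f x) - \<psi> x * q2 x))"
    unfolding Re[symmetric] Im[symmetric]
  proof (rule weighted_norm_eq)
    show "sq_integrable (\<lambda>x. Re ((f - g) x))" "sq_integrable (\<lambda>x. Im ((f - g) x))"
      unfolding Re Im using q1(1) q2(1)
      by (intro sq_integrable_diff weighted_L2_Re_Im[OF f] sq_integrable_continuous
          continuous_intros \<psi>c; simp add: R_def)+
  qed
  also have "\<dots> < sqrt (e\<^sup>2)"
    using q1(2) q2(2) by (intro real_sqrt_less_mono) simp
  finally have "weighted_norm a b w (f - g) < e"
    using \<open>0 < e\<close> by simp
  moreover have "g \<in> ?V"
    unfolding g_def using q1(1) q2(1) V.span_base[OF \<psi>]
    by (intro add_V scale_V) (auto simp: R_def)
  ultimately show "\<exists>g\<in>?V. weighted_norm a b w (f - g) < e"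
    by blast
qed

end

section \<open>The phase function and the Liouville-Green modes\<close>

lemma integral_strict_mono_on:
  fixes g :: "real \<Rightarrow> real"
  assumes g: "continuous_on {a..b} g" and pos: "\<And>x. x \<in> {a..b} \<Longrightarrow> 0 < g x"
  shows "strict_mono_on {a..b} (\<lambda>r. integral {a..r} g)"
proof (rule strict_mono_onI)
  fix r s assume rs: "r \<in> {a..b}" "s \<in> {a..b}" "r < s"
  show "integral {a..r} g < integral {a..s} g"
  \<comment> \<open>The fundamental theorem of calculus gives the derivative \<open>g x\<close> > 0
    at interior points; at \<open>r\<close> and \<open>s\<close> continuity is enough.\<close>
  proof (rule DERIV_pos_imp_increasing_open[OF \<open>r < s\<close>])
    fix x assume x: "r < x" "x < s"
    have "((\<lambda>r. integral {a..r} g) has_real_derivative g x) (at x within {a..b})"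
      using rs x by (intro integral_has_real_derivative g) auto
    then have "((\<lambda>r. integral {a..r} g) has_real_derivative g x) (at x)"
      using rs x by (subst (asm) at_within_interior) (auto simp: interior_atLeastAtMost_real)
    with pos[of x] show "\<exists>y. ((\<lambda>r. integral {a..r} g) has_real_derivative y) (at x) \<and> 0 < y"
      using rs x by auto
  next
    have "continuous_on {a..b} (\<lambda>r. integral {a..r} g)"
      by (intro indefinite_integral_continuous_1 integrable_continuous_interval g)
    then show "continuous_on {r..s} (\<lambda>r. integral {a..r} g)"
      by (rule continuous_on_subset) (use rs in auto)
  qed
qed

text \<open>Product-to-sum formula: the amplitude is a common factor, so multiplication by the
  cosine of the phase gives half the sum of the two neighbouring modes.\<close>

lemma cos_mult_LG_quasimode:
  assumes "1 \<le> m"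
  shows "(\<lambda>r. complex_of_real (cos (pi / L * \<xi> r)) * LG_quasimode p \<rho> \<xi> L m r)
    \<in> complex_span {LG_quasimode p \<rho> \<xi> L m | m. 1 \<le> m}" (is "_ \<in> complex_span ?S")
proof -
  interpret V: vector_space fun_scale by (rule vector_space_fun_scale)
  let ?Q = "LG_quasimode p \<rho> \<xi> L"
  \<comment> \<open>For \<open>m\<close> = 1 the lower neighbour has index 0, outside the system. It
    is the zero function, hence still in the span.\<close>
  have Q0: "?Q 0 = 0"
    by (simp add: LG_quasimode_def fun_eq_iff)
  have Q: "?Q k \<in> complex_span ?S" for k
    by (cases "k = 0") (use V.span_zero in \<open>auto simp: Q0 intro!: V.span_base\<close>)
  have "(\<lambda>r. complex_of_real (cos (pi / L * \<xi> r)) * ?Q m r)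
      = fun_scale (1/2) (?Q (m + 1) + ?Q (m - 1))"
  proof
    fix r
    define t where "t = pi / L * \<xi> r"
    have t: "pi * real k / L * \<xi> r = real k * t" for k
      by (simp add: t_def)
    \<comment> \<open>The bound 1 <= \<open>m\<close> makes the natural number subtraction agree
      with the real one.\<close>
    have "real (m + 1) * t = real m * t + t" "real (m - 1) * t = real m * t - t"
      using assms by (auto simp: algebra_simps of_nat_diff)
    then have "cos t * sin (real m * t) = (sin (real (m + 1) * t) + sin (real (m - 1) * t)) / 2"
      by (simp add: sin_add sin_diff)
    then have "cos t * (K * sin (real m * t))
        = 1 / 2 * (K * sin (real (m + 1) * t) + K * sin (real (m - 1) * t))" for K
      by (subst mult.left_commute) (simp add: add_divide_distrib distrib_left)
    from arg_cong[OF this[of "1 / (p r * \<rho> r) powr (1/4)"], of complex_of_real]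
    show "complex_of_real (cos (pi / L * \<xi> r)) * ?Q m r
        = fun_scale (1/2) (?Q (m + 1) + ?Q (m - 1)) r"
      unfolding LG_quasimode_def fun_scale_def plus_fun_def t t_def[symmetric]
      by (simp only: of_real_mult of_real_add of_real_divide of_real_1 of_real_numeral)
  qed
  then show ?thesis
    by (simp only: V.span_scale V.span_add Q)
qed

theorem mainTheorem4:
  fixes r0 r1 r2 L :: real and p \<rho> \<xi> :: "real \<Rightarrow> real"
  assumes "0 < r0" and "r0 < r1" and "r1 < r2"
    and "\<And>r. r \<in> {r1..r2} \<Longrightarrow> p r = 1 / r"
    and "\<And>r. r \<in> {r1..r2} \<Longrightarrow> \<rho> r = 1 / r * (r\<^sup>2 / r0\<^sup>2 - 1)"
    and "\<And>r. r \<in> {r1..r2} \<Longrightarrow> \<xi> r = integral {r1..r} (\<lambda>s. sqrt (s\<^sup>2 / r0\<^sup>2 - 1))"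
    and "L = \<xi> r2"
  shows "complete_in_weighted_L2 r1 r2 \<rho> {LG_quasimode p \<rho> \<xi> L m | m. 1 \<le> m}"
proof -
  define n where "n s = sqrt (s\<^sup>2 / r0\<^sup>2 - 1)" for s
  \<comment> \<open>The strict inequality r0 < r1 keeps the radicand positive up to the left
    endpoint, so the integrand of the phase and the weight are positive on the whole closed
    interval.\<close>
  have gt1: "1 < s\<^sup>2 / r0\<^sup>2" if "s \<in> {r1..r2}" for s
    using that assms(1,2) by (simp add: power_strict_mono)
  have n_cont: "continuous_on {r1..r2} n"
    unfolding n_def using assms(1) by (intro continuous_intros) simp
  have n_pos: "0 < n s" if "s \<in> {r1..r2}" for s
    using gt1[OF that] by (simp add: n_def)
  have \<xi>: "\<xi> r = integral {r1..r} n" if "r \<in> {r1..r2}" for r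
    using assms(6)[OF that] unfolding n_def .
  have \<xi>_cont: "continuous_on {r1..r2} \<xi>"
    using indefinite_integral_continuous_1[OF integrable_continuous_interval[OF n_cont]]
    by (subst continuous_on_cong[OF refl \<xi>]) auto
  have \<xi>_mono: "\<xi> r < \<xi> s" if "r \<in> {r1..r2}" "s \<in> {r1..r2}" "r < s" for r s
    using strict_mono_onD[OF integral_strict_mono_on[OF n_cont n_pos] that] that by (simp add: \<xi>)
  have \<xi>1: "\<xi> r1 = 0"
    using assms(3) by (simp add: \<xi>)
  have L_pos: "0 < L"
    using \<xi>_mono[of r1 r2] assms(3,7) \<xi>1 by simp
  \<comment> \<open>The normalised phase increases strictly from 0 to pi; on that range the cosine
    is injective, and the sine is positive in the interior.\<close>
  define \<theta> where "\<theta> r = pi / L * \<xi> r" for r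
  have \<theta>_mono: "\<theta> r < \<theta> s" if "r \<in> {r1..r2}" "s \<in> {r1..r2}" "r < s" for r s
    using \<xi>_mono[OF that] L_pos by (simp add: \<theta>_def divide_simps)
  have \<theta>_ends: "\<theta> r1 = 0" "\<theta> r2 = pi"
    using \<xi>1 assms(7) L_pos by (auto simp: \<theta>_def)
  have \<theta>_open: "0 < \<theta> r" "\<theta> r < pi" if "r \<in> {r1<..<r2}" for r
    using \<theta>_mono[of r1 r] \<theta>_mono[of r r2] that \<theta>_ends by auto
  have \<theta>_range: "0 \<le> \<theta> r" "\<theta> r \<le> pi" if "r \<in> {r1..r2}" for r
    using \<theta>_open[of r] \<theta>_ends that by (cases "r = r1"; cases "r = r2"; auto)+
  have r_pos: "0 < r" if "r \<in> {r1..r2}" for r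
    using that assms(1,2) by simp
  have \<rho>_pos: "0 < \<rho> r" if "r \<in> {r1..r2}" for r
    using gt1[OF that] r_pos[OF that] by (simp add: assms(5)[OF that])
  have p_pos: "0 < p r" if "r \<in> {r1..r2}" for r
    using r_pos[OF that] by (simp add: assms(4)[OF that])
  have p_cont: "continuous_on {r1..r2} p"
    using assms(1,2)
    by (subst continuous_on_cong[OF refl assms(4)]) (assumption, intro continuous_intros, auto)
  have \<rho>_cont: "continuous_on {r1..r2} \<rho>"
    using assms(1,2)
    by (subst continuous_on_cong[OF refl assms(5)]) (assumption, intro continuous_intros, auto)
  have pow_pos: "0 < (p r * \<rho> r) powr (1/4)" if "r \<in> {r1..r2}" for r
    using p_pos[OF that] \<rho>_pos[OF that] by simp
  interpret interval_weight r1 r2 \<rho>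
    by standard (use \<rho>_cont \<rho>_pos in \<open>auto intro: less_imp_le\<close>)
  \<comment> \<open>The mode with \<open>m\<close> = 1 is the one without zeros in the open
    interval; the higher modes change sign there.\<close>
  define \<psi> where "\<psi> r = 1 / (p r * \<rho> r) powr (1/4) * sin (\<theta> r)" for r
  show ?thesis
  proof (rule complete_of_multipliers)
    show "continuous_on {r1..r2} g" if "g \<in> {LG_quasimode p \<rho> \<xi> L m | m. 1 \<le> m}" for g
    proof -
      have "continuous_on {r1..r2} (LG_quasimode p \<rho> \<xi> L m)" for m
        unfolding LG_quasimode_def using L_pos p_pos \<rho>_pos
        by (intro continuous_intros p_cont \<rho>_cont \<xi>_cont) (force simp: less_le)+
      with that show ?thesis by auto
    qed
    have "(\<lambda>r. complex_of_real (\<psi> r)) = LG_quasimode p \<rho> \<xi> L 1"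
      by (simp add: LG_quasimode_def \<psi>_def \<theta>_def)
    then show "(\<lambda>r. complex_of_real (\<psi> r)) \<in> {LG_quasimode p \<rho> \<xi> L m | m. 1 \<le> m}"
      by blast
    show "0 < \<psi> r" if "r \<in> {r1<..<r2}" for r
      using pow_pos[of r] \<theta>_open[OF that] that by (simp add: \<psi>_def sin_gt_zero)
    show "continuous_on {r1..r2} (\<lambda>r. cos (\<theta> r))"
      unfolding \<theta>_def using L_pos by (intro continuous_intros \<xi>_cont) auto
    show "inj_on (\<lambda>r. cos (\<theta> r)) {r1..r2}"
    proof (rule inj_onI)
      fix r s assume rs: "r \<in> {r1..r2}" "s \<in> {r1..r2}" and "cos (\<theta> r) = cos (\<theta> s)"
      then have "\<theta> r = \<theta> s"
        by (metis cos_inj_pi \<theta>_range)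
      then show "r = s"
        using \<theta>_mono[OF rs] \<theta>_mono[OF rs(2,1)] by (cases r s rule: linorder_cases) simp_all
    qed
    show "(\<lambda>r. complex_of_real (cos (\<theta> r)) * g r)
        \<in> complex_span {LG_quasimode p \<rho> \<xi> L m | m. 1 \<le> m}"
      if g: "g \<in> {LG_quasimode p \<rho> \<xi> L m | m. 1 \<le> m}" for g
    proof -
      obtain m where m: "g = LG_quasimode p \<rho> \<xi> L m" "1 \<le> m"
        using g by blast
      show ?thesis
        unfolding \<theta>_def m(1) by (rule cos_mult_LG_quasimode[OF m(2)])
    qed
  qed
qed

end
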